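(* For $n\ge 3$ and $p\mid n$, let $\omega=e^{2\pi i/n}$ and $$G(n,p,2)=\Bigl\langle\begin{pmatrix}0&1\\1&0\end{pmatrix},\ \begin{pmatrix}0&\omega\\ \overline{\omega}&0\end{pmatrix},\ \begin{pmatrix}\omega^p&0\\0&1\end{pmatrix}\Bigr\rangle .$$ The systems of imprimitivity of these groups (viewed as groups of matrices over $\mathbb{H}$), in addition to the standard basis, are those given by $(1,q)$, $q\in\mathbb{H}$, $q\ne0$, in the following cases: (a) $(1,1)$ and $(1,i)$, for $G(4,4,2)$ and $G(4,2,2)$ (the last group contains the first); (b) $(1,zj)$, $z\in\mathbb{C}$, $z\ne0$, for $G(n,n,2)$; (c) $(1,zj)$, $z\in\mathbb{C}$, $|z|=1$, for $G(n,\frac n2,2)$, when $n$ is even. Moreover, $G(4,4,2)$ is conjugate in $\mathrm{GL}(\mathbb{C}^2)$ to the real reflection group $D_4=G(2,1,2)$, and there is the inclusion $G(n,n,2)\subset G(n,\frac n2,2)$ for $n$ even.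
   Context: $\mathbb{H}$ denotes the quaternions with standard units $i,j,k$, and $\mathbb{C}=\mathbb{R}+\mathbb{R}i\subset\mathbb{H}$. $\mathbb{H}^2$ is a right vector space (matrices act on the left) with inner product $\langle v,w\rangle=\sum_j\overline{v_j}w_j$. A system of imprimitivity of a group $G\subset\mathrm{GL}(\mathbb{H}^2)$ is an unordered pair $\{V_1,V_2\}$ of one-dimensional subspaces with $\mathbb{H}^2=V_1\oplus V_2$ which is permuted by every element of $G$. The system given by $(1,q)$ is the pair consisting of the span of $(1,q)$ and its orthogonal complement, the span of $(-\overline{q},1)$. Different $q$ may give the same system (e.g. $(1,q)$ and $(1,-q/|q|^2)$ do). The group $D_4=G(2,1,2)$ is the dihedral group of order $8$ generated by $\begin{pmatrix}0&-1\\1&0\end{pmatrix}$ and $\begin{pmatrix}1&0\\0&-1\end{pmatrix}$. *)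

theory Defs
  imports "HOL-Analysis.Analysis" "HOL-Algebra.Generated_Groups"
begin

section \<open>Quaternions\<close>

codatatype quat = Quat (qRe: real) (qI: real) (qJ: real) (qK: real)

lemma quat_eq_iff: "x = y \<longleftrightarrow> qRe x = qRe y \<and> qI x = qI y \<and> qJ x = qJ y \<and> qK x = qK y"
  by (auto intro: quat.expand)

instantiation quat :: division_ring
begin

primcorec zero_quat where
  "qRe 0 = 0" | "qI 0 = 0" | "qJ 0 = 0" | "qK 0 = 0"

primcorec one_quat where
  "qRe 1 = 1" | "qI 1 = 0" | "qJ 1 = 0" | "qK 1 = 0"

primcorec plus_quat where
  "qRe (x + y) = qRe x + qRe y"
| "qI (x + y) = qI x + qI y"
| "qJ (x + y) = qJ x + qJ y"
| "qK (x + y) = qK x + qK y"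

primcorec uminus_quat where
  "qRe (- x) = - qRe x" | "qI (- x) = - qI x" | "qJ (- x) = - qJ x" | "qK (- x) = - qK x"

primcorec minus_quat where
  "qRe (x - y) = qRe x - qRe y"
| "qI (x - y) = qI x - qI y"
| "qJ (x - y) = qJ x - qJ y"
| "qK (x - y) = qK x - qK y"

primcorec times_quat where
  "qRe (x * y) = qRe x * qRe y - qI x * qI y - qJ x * qJ y - qK x * qK y"
| "qI (x * y) = qRe x * qI y + qI x * qRe y + qJ x * qK y - qK x * qJ y"
| "qJ (x * y) = qRe x * qJ y - qI x * qK y + qJ x * qRe y + qK x * qI y"
| "qK (x * y) = qRe x * qK y + qI x * qJ y - qJ x * qI y + qK x * qRe y"

primcorec inverse_quat where
  "qRe (inverse x) = qRe x / ((qRe x)\<^sup>2 + (qI x)\<^sup>2 + (qJ x)\<^sup>2 + (qK x)\<^sup>2)"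
| "qI (inverse x) = - qI x / ((qRe x)\<^sup>2 + (qI x)\<^sup>2 + (qJ x)\<^sup>2 + (qK x)\<^sup>2)"
| "qJ (inverse x) = - qJ x / ((qRe x)\<^sup>2 + (qI x)\<^sup>2 + (qJ x)\<^sup>2 + (qK x)\<^sup>2)"
| "qK (inverse x) = - qK x / ((qRe x)\<^sup>2 + (qI x)\<^sup>2 + (qJ x)\<^sup>2 + (qK x)\<^sup>2)"

definition divide_quat :: "quat \<Rightarrow> quat \<Rightarrow> quat" where
  "x div y = x * inverse y" for x y :: quat

instance
proof
  fix a b c :: quat
  show "a * b * c = a * (b * c)"
    by (simp add: quat_eq_iff algebra_simps)
  show "(a + b) * c = a * c + b * c"
    by (simp add: quat_eq_iff algebra_simps)
  show "a * (b + c) = a * b + a * c"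
    by (simp add: quat_eq_iff algebra_simps)
  show "inverse a * a = 1" "a * inverse a = 1" if "a \<noteq> 0"
  proof -
    let ?s = "(qRe a)\<^sup>2 + (qI a)\<^sup>2 + (qJ a)\<^sup>2 + (qK a)\<^sup>2"
    have "?s = 0 \<Longrightarrow> a = 0"
      by (auto simp: quat_eq_iff add_nonneg_eq_0_iff)
    with that have s: "?s \<noteq> 0" by blast
    have "(qRe a * qRe a + qI a * qI a + qJ a * qJ a + qK a * qK a) / ?s = 1"
      using s by (simp add: power2_eq_square)
    then have e: "qRe a * qRe a / ?s + qI a * qI a / ?s + qJ a * qJ a / ?s + qK a * qK a / ?s = 1"
      by (simp add: add_divide_distrib)
    show "inverse a * a = 1" "a * inverse a = 1"
      using e by (simp_all add: quat_eq_iff mult.commute)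
  qed
qed (auto simp: quat_eq_iff divide_quat_def)

end

primcorec qcnj :: "quat \<Rightarrow> quat" where
  "qRe (qcnj x) = qRe x" | "qI (qcnj x) = - qI x" | "qJ (qcnj x) = - qJ x" | "qK (qcnj x) = - qK x"

definition quat_i :: quat where "quat_i = Quat 0 1 0 0"
definition quat_j :: quat where "quat_j = Quat 0 0 1 0"
definition quat_k :: quat where "quat_k = Quat 0 0 0 1"

lemma quat_units:
  "quat_i * quat_i = - 1" "quat_j * quat_j = - 1" "quat_k * quat_k = - 1"
  "quat_i * quat_j = quat_k" "quat_j * quat_k = quat_i" "quat_k * quat_i = quat_j"
  by (simp_all add: quat_eq_iff quat_i_def quat_j_def quat_k_def)

definition quat_of_complex :: "complex \<Rightarrow> quat" where
  "quat_of_complex z = Quat (Re z) (Im z) 0 0"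

lemma quat_of_complex_simps [simp]:
  "quat_of_complex 0 = 0" "quat_of_complex 1 = 1" "quat_of_complex \<i> = quat_i"
  "quat_of_complex (x + y) = quat_of_complex x + quat_of_complex y"
  "quat_of_complex (x * y) = quat_of_complex x * quat_of_complex y"
  "quat_of_complex (cnj x) = qcnj (quat_of_complex x)"
  "quat_of_complex x = quat_of_complex y \<longleftrightarrow> x = y"
  by (auto simp: quat_eq_iff quat_of_complex_def quat_i_def complex_eq_iff)

section \<open>The right vector space $\mathbb{H}^n$\<close>

text \<open>
  The scalars act from the right, so that \<^term>\<open>(*v)\<close> (matrices acting from the left) is linear.
  The library's vector spaces are over commutative scalars and do not apply here.
\<close>

definition rscale :: "quat ^ 'n \<Rightarrow> quat \<Rightarrow> quat ^ 'n" where
  "rscale v a = (\<chi> i. v $ i * a)"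

definition rsubspace :: "(quat ^ 'n) set \<Rightarrow> bool" where
  "rsubspace V \<longleftrightarrow> 0 \<in> V \<and> (\<forall>v\<in>V. \<forall>w\<in>V. v + w \<in> V) \<and> (\<forall>v\<in>V. \<forall>a. rscale v a \<in> V)"

definition rspan :: "(quat ^ 'n) set \<Rightarrow> (quat ^ 'n) set" where
  "rspan S = rsubspace hull S"

definition one_dimensional :: "(quat ^ 'n) set \<Rightarrow> bool" where
  "one_dimensional V \<longleftrightarrow> (\<exists>v. v \<noteq> 0 \<and> V = rspan {v})"

definition qinner :: "quat ^ 'n \<Rightarrow> quat ^ 'n \<Rightarrow> quat" where
  "qinner v w = (\<Sum>i\<in>UNIV. qcnj (v $ i) * w $ i)"

definition orth_compl :: "(quat ^ 'n) set \<Rightarrow> (quat ^ 'n) set" where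
  "orth_compl V = {w. \<forall>v\<in>V. qinner v w = 0}"

definition is_direct_sum :: "(quat ^ 'n) set \<Rightarrow> (quat ^ 'n) set \<Rightarrow> bool" where
  "is_direct_sum V W \<longleftrightarrow> V \<inter> W = {0} \<and> {v + w | v w. v \<in> V \<and> w \<in> W} = UNIV"

lemma rspan_singleton: "rspan {v} = range (rscale v)"
  unfolding rspan_def
proof (rule hull_unique)
  have "rscale v 1 = v" by (simp add: rscale_def vec_eq_iff)
  then show "{v} \<subseteq> range (rscale v)" by (metis empty_subsetI insert_subset rangeI)
  have zero: "rscale v 0 = 0"
    and add: "rscale v a + rscale v b = rscale v (a + b)"
    and scale: "rscale (rscale v a) b = rscale v (a * b)" for a b
    by (simp_all add: rscale_def vec_eq_iff distrib_left mult.assoc)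
  show "rsubspace (range (rscale v))"
    unfolding rsubspace_def by (auto simp: add scale) (metis zero rangeI)
next
  show "range (rscale v) \<subseteq> W" if "{v} \<subseteq> W" "rsubspace W" for W
    using that by (auto simp: rsubspace_def)
qed

section \<open>Systems of imprimitivity\<close>

definition imprimitivity_system :: "(quat ^ 2 ^ 2) set \<Rightarrow> (quat ^ 2) set set \<Rightarrow> bool" where
  "imprimitivity_system G S \<longleftrightarrow>
     (\<exists>V1 V2. S = {V1, V2} \<and> one_dimensional V1 \<and> one_dimensional V2 \<and> is_direct_sum V1 V2) \<and>
     (\<forall>g\<in>G. (\<lambda>V. (*v) g ` V) ` S = S)"

definition standard_system :: "(quat ^ 2) set set" where
  "standard_system = {rspan {vector [1, 0]}, rspan {vector [0, 1]}}"

definition system_given_by :: "quat \<Rightarrow> (quat ^ 2) set set" where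
  "system_given_by q = {rspan {vector [1, q]}, orth_compl (rspan {vector [1, q]})}"

lemma system_given_by_altdef:
  "system_given_by q = {rspan {vector [1, q]}, rspan {vector [- qcnj q, 1]}}"
proof -
  have cnj_mult: "qcnj (a * b) = qcnj b * qcnj a" for a b
    by (simp add: quat_eq_iff algebra_simps)
  have cnj_1: "qcnj 1 = 1"
    by (simp add: quat_eq_iff)
  have orth: "w \<in> orth_compl (rspan {vector [1, q]}) \<longleftrightarrow> w $ 1 = - qcnj q * w $ 2" for w :: "quat ^ 2"
  proof -
    have "qinner (rscale (vector [1, q]) a) w = qcnj a * (w $ 1 + qcnj q * w $ 2)" for a
      by (simp add: qinner_def sum_2 rscale_def cnj_mult cnj_1 distrib_left mult.assoc)
    then have eq: "w \<in> orth_compl (rspan {vector [1, q]}) \<longleftrightarrow>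
        (\<forall>a. qcnj a * (w $ 1 + qcnj q * w $ 2) = 0)"
      by (simp add: orth_compl_def rspan_singleton)
    show ?thesis
    proof
      assume "w \<in> orth_compl (rspan {vector [1, q]})"
      then have "qcnj 1 * (w $ 1 + qcnj q * w $ 2) = 0" using eq by blast
      then show "w $ 1 = - qcnj q * w $ 2" by (simp add: cnj_1 eq_neg_iff_add_eq_0)
    next
      assume "w $ 1 = - qcnj q * w $ 2"
      then show "w \<in> orth_compl (rspan {vector [1, q]})" by (simp add: eq)
    qed
  qed
  have "w \<in> rspan {vector [- qcnj q, 1]} \<longleftrightarrow> w $ 1 = - qcnj q * w $ 2" for w :: "quat ^ 2"
    by (auto simp: rspan_singleton rscale_def vec_eq_iff forall_2 image_iff)
  then have "orth_compl (rspan {vector [1, q]}) = rspan {vector [- qcnj q, 1] :: quat ^ 2}"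
    using orth by blast
  then show ?thesis
    by (simp add: system_given_by_def)
qed

section \<open>The groups\<close>

definition GL :: "('a::semiring_1 ^ 'n ^ 'n) monoid" where
  "GL = \<lparr>carrier = {A. invertible A}, mult = (**), one = mat 1\<rparr>"

lemma group_GL: "group (GL :: ('a::semiring_1 ^ 'n ^ 'n) monoid)"
proof (rule groupI)
  fix x y :: "'a ^ 'n ^ 'n"
  assume "x \<in> carrier GL" "y \<in> carrier GL"
  then show "x \<otimes>\<^bsub>GL\<^esub> y \<in> carrier GL" by (simp add: GL_def invertible_mult)
next
  fix x :: "'a ^ 'n ^ 'n"
  assume "x \<in> carrier GL"
  then obtain y where "x ** y = mat 1" "y ** x = mat 1" by (auto simp: GL_def invertible_def)
  then show "\<exists>y\<in>carrier GL. y \<otimes>\<^bsub>GL\<^esub> x = \<one>\<^bsub>GL\<^esub>" by (auto simp: GL_def invertible_def)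
qed (auto simp: GL_def matrix_mul_assoc invertible_def)

definition Gnp2 :: "nat \<Rightarrow> nat \<Rightarrow> (complex ^ 2 ^ 2) set" where
  "Gnp2 n p = (let \<omega> = exp (2 * complex_of_real pi * \<i> / of_nat n) in
     generate GL
       {vector [vector [0, 1], vector [1, 0]],
        vector [vector [0, \<omega>], vector [cnj \<omega>, 0]],
        vector [vector [\<omega> ^ p, 0], vector [0, 1]]})"

definition D4 :: "(complex ^ 2 ^ 2) set" where
  "D4 = generate GL
     {vector [vector [0, - 1], vector [1, 0]],
      vector [vector [1, 0], vector [0, - 1]]}"

definition over_quat :: "(complex ^ 'n ^ 'n) set \<Rightarrow> (quat ^ 'n ^ 'n) set" where
  "over_quat G = map_matrix quat_of_complex ` G"

lemma map_matrix_hom_GL: "map_matrix quat_of_complex \<in> hom GL (GL :: (quat ^ 'n ^ 'n) monoid)"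
proof -
  have qsum: "quat_of_complex (sum f A) = (\<Sum>i\<in>A. quat_of_complex (f i))" for f and A :: "'n set"
    by (induction A rule: infinite_finite_induct) auto
  have mult: "map_matrix quat_of_complex (A ** B) =
      map_matrix quat_of_complex A ** map_matrix quat_of_complex B" for A B :: "complex ^ 'n ^ 'n"
    by (simp add: vec_eq_iff matrix_matrix_mult_def qsum)
  have one: "map_matrix quat_of_complex (mat 1 :: complex ^ 'n ^ 'n) = mat 1"
    by (simp add: vec_eq_iff mat_def)
  have "invertible (map_matrix quat_of_complex A)" if "invertible A" for A :: "complex ^ 'n ^ 'n"
    using that unfolding invertible_def by (metis mult one)
  then show ?thesis
    by (auto simp: hom_def GL_def mult)
qed

lemma subgroup_over_quat_Gnp2: "subgroup (over_quat (Gnp2 n p)) GL"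
proof -
  interpret group_hom "GL :: (complex ^ 2 ^ 2) monoid" GL "map_matrix quat_of_complex"
    by (intro group_hom.intro group_hom_axioms.intro group_GL map_matrix_hom_GL)
  define \<omega> where "\<omega> = exp (2 * complex_of_real pi * \<i> / of_nat n)"
  have n: "\<omega> * cnj \<omega> = 1"
    unfolding \<omega>_def by (simp add: exp_cnj flip: exp_add)
  have det: "det (A :: complex ^ 2 ^ 2) \<noteq> 0 \<Longrightarrow> A \<in> carrier GL" for A
    by (simp add: GL_def invertible_det_nz)
  have "subgroup (Gnp2 n p) GL"
    unfolding Gnp2_def Let_def \<omega>_def[symmetric]
  proof (rule G.generate_is_subgroup, safe intro!: det)
    show "det (vector [vector [\<omega> ^ p, 0], vector [0, 1]] :: complex ^ 2 ^ 2) = 0 \<Longrightarrow> False"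
      by (simp add: det_2 \<omega>_def)
  qed (simp_all add: det_2 n)
  then show ?thesis
    unfolding over_quat_def by (rule subgroup_img_is_subgroup)
qed

definition conjugate_in_GL :: "('a::semiring_1 ^ 'n ^ 'n) set \<Rightarrow> ('a ^ 'n ^ 'n) set \<Rightarrow> bool" where
  "conjugate_in_GL G H \<longleftrightarrow> (\<exists>A. invertible A \<and> (\<lambda>g. A ** g ** matrix_inv A) ` G = H)"

end

theory Submission
  imports Defs
begin

text \<open>
  A line of \<open>\<H>\<^sup>2\<close> other than the vertical axis is spanned by \<open>(1, q)\<close> for exactly one quaternion \<open>q\<close>, its
  slope, and any two distinct lines are complementary.  A system of imprimitivity is therefore an
  unordered pair of slopes in the projective line \<open>\<H> \<union> {\<infinity>}\<close>, invariant under the three generators.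
  The swap exchanges \<open>0\<close> and \<open>\<infinity>\<close>, so a pair containing one of them is the standard system.  On
  nonzero slopes the generators act by
  \<open>q \<mapsto> q\<^sup>-\<^sup>1\<close>, \<open>q \<mapsto> u q\<^sup>-\<^sup>1 u\<close> and \<open>q \<mapsto> q u\<^sup>p\<close>, where \<open>u\<close> is the conjugate of \<open>\<omega>\<close>.
  
  The key is the product of the first two maps, \<open>\<rho> q = u q u\<close>.  Written as \<open>q = a + b j\<close> with complex
  \<open>a\<close> and \<open>b\<close>, it is \<open>\<rho> q = u\<^sup>2 a + b j\<close>, because \<open>j\<close> conjugates the complex numbers it passes.  Let
  \<open>{q, r}\<close> be an invariant pair.
  
  If \<open>a \<noteq> 0\<close>, then \<open>\<rho>\<close> moves \<open>q\<close> since \<open>u\<^sup>2 \<noteq> 1\<close>; it must exchange \<open>q\<close> and \<open>r\<close>, so \<open>u\<^sup>4 = 1\<close>,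
  that is \<open>n = 4\<close>, and \<open>r = - a + b j\<close>.  Comparing the \<open>j\<close>-parts of \<open>q\<^sup>-\<^sup>1 \<in> {q, r}\<close> gives \<open>b = 0\<close>,
  and then \<open>a\<^sup>2 = \<plusminus>1\<close>.  The last generator multiplies \<open>a\<close> by \<open>u\<^sup>p\<close>, which must be \<open>\<plusminus>1\<close>, so \<open>p\<close>
  is \<open>4\<close> or \<open>2\<close>.
  
  If \<open>a = 0\<close>, then \<open>q\<^sup>-\<^sup>1 = - q / \<bar>q\<bar>\<^sup>2\<close> differs from \<open>q\<close>, so it equals \<open>r\<close>; this is also the slope
  of the orthogonal complement.  The last generator sends \<open>b\<close> to \<open>b \<omega>\<^sup>p\<close>, which must be \<open>b\<close> or
  \<open>- b / \<bar>b\<bar>\<^sup>2\<close>.  The first means \<open>p = n\<close>; the second means \<open>\<bar>b\<bar> = 1\<close> and \<open>\<omega>\<^sup>p = - 1\<close>, that is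
  \<open>2 p = n\<close>.
  
  The two directions are \<open>invariant_pair_imp\<close> and \<open>admissible_imp_invariant_pair\<close>; the lemma
  \<open>imprimitivity_system_Gnp2_iff\<close> carries them over to the groups.  The conjugacy of \<open>G(4,4,2)\<close> with
  \<open>D\<^sub>4\<close> is the change of basis that diagonalises the swap.
\<close>

section \<open>Quaternions as pairs of complex numbers\<close>

text \<open>The Cayley--Dickson form \<open>a + b j\<close> of a quaternion.\<close>

definition cd :: "complex \<Rightarrow> complex \<Rightarrow> quat" where
  "cd a b = quat_of_complex a + quat_of_complex b * quat_j"

lemma cd_eq_Quat: "cd a b = Quat (Re a) (Im a) (Re b) (Im b)"
  by (simp add: quat_eq_iff cd_def quat_of_complex_def quat_j_def)

lemma cd_exhaust:
  obtains a b where "q = cd a b"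
  by (rule that[of "Complex (qRe q) (qI q)" "Complex (qJ q) (qK q)"])
    (simp add: cd_eq_Quat)

lemma cd_inject: "cd a b = cd c d \<longleftrightarrow> a = c \<and> b = d"
  by (auto simp: cd_eq_Quat complex_eq_iff)

lemma quat_of_complex_eq_cd: "quat_of_complex z = cd z 0"
  by (simp add: cd_def)

lemma complex_times_j_eq_cd: "quat_of_complex z * quat_j = cd 0 z"
  by (simp add: cd_def)

lemma zero_eq_cd: "0 = cd 0 0"
  by (simp add: cd_def)

lemma uminus_cd: "- cd a b = cd (- a) (- b)"
  by (simp add: cd_eq_Quat quat_eq_iff)

lemma cd_mult: "cd a b * cd c d = cd (a * c - b * cnj d) (a * d + b * cnj c)"
  by (simp add: cd_eq_Quat quat_eq_iff algebra_simps)

lemma qcnj_cd: "qcnj (cd a b) = cd (cnj a) (- b)"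
  by (simp add: cd_eq_Quat quat_eq_iff)

definition cd_norm2 :: "complex \<Rightarrow> complex \<Rightarrow> real" where
  "cd_norm2 a b = (cmod a)\<^sup>2 + (cmod b)\<^sup>2"

lemma cd_norm2_nonneg: "cd_norm2 a b \<ge> 0"
  by (simp add: cd_norm2_def)

lemma cd_norm2_eq_0_iff: "cd_norm2 a b = 0 \<longleftrightarrow> a = 0 \<and> b = 0"
  by (simp add: cd_norm2_def add_nonneg_eq_0_iff)

lemma inverse_cd:
  "inverse (cd a b) = cd (cnj a / of_real (cd_norm2 a b)) (- b / of_real (cd_norm2 a b))"
  by (simp add: cd_eq_Quat quat_eq_iff cd_norm2_def cmod_power2 add.assoc)

lemma quat_of_complex_inverse: "inverse (quat_of_complex z) = quat_of_complex (inverse z)"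
  by (simp add: quat_eq_iff quat_of_complex_def)

text \<open>
  The slope of the orthogonal complement of the line with slope \<open>q \<noteq> 0\<close>, that is, the image of \<open>q\<close>
  under the antipodal map of the 4-sphere \<open>\<H> \<union> {\<infinity>}\<close>.
\<close>
definition antipode :: "quat \<Rightarrow> quat" where
  "antipode q = - inverse (qcnj q)"

lemma antipode_cd:
  "antipode (cd a b) = cd (- a / of_real (cd_norm2 a b)) (- b / of_real (cd_norm2 a b))"
  by (simp add: antipode_def qcnj_cd inverse_cd uminus_cd cd_norm2_def)

text \<open>
  The antipode is a negative real multiple of \<open>q\<close>.
\<close>

lemma antipode_ne:
  assumes "q \<noteq> 0"
  shows "antipode q \<noteq> q"
proof -
  obtain a b where q: "q = cd a b" by (rule cd_exhaust)
  have N: "cd_norm2 a b > 0"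
    using assms cd_norm2_nonneg[of a b] cd_norm2_eq_0_iff[of a b]
    by (auto simp: q zero_eq_cd cd_inject less_le)
  have "x = 0" if "- x / complex_of_real (cd_norm2 a b) = x" for x
  proof -
    have "x * of_real (1 + cd_norm2 a b) = 0"
      using that N by (simp add: field_simps) (metis add.right_inverse)
    then show ?thesis
      using N by (metis add_pos_pos less_irrefl mult_eq_0_iff of_real_eq_0_iff zero_less_one)
  qed
  then show ?thesis
    using assms by (auto simp: q antipode_cd zero_eq_cd cd_inject)
qed

lemma antipode_nonzero: "q \<noteq> 0 \<Longrightarrow> antipode q \<noteq> 0"
proof -
  assume "q \<noteq> 0"
  then have "qcnj q \<noteq> 0" by (auto simp: quat_eq_iff)
  then show ?thesis by (simp add: antipode_def)
qed

section \<open>Lines and their slopes\<close>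

abbreviation line :: "quat \<Rightarrow> (quat ^ 2) set" where
  "line q \<equiv> rspan {vector [1, q]}"

abbreviation vertical_line :: "(quat ^ 2) set" where
  "vertical_line \<equiv> rspan {vector [0, 1]}"

lemma mem_line: "w \<in> line q \<longleftrightarrow> w $ 2 = q * w $ 1"
  by (auto simp: rspan_singleton rscale_def vec_eq_iff forall_2 image_iff)

lemma mem_vertical_line: "w \<in> vertical_line \<longleftrightarrow> w $ 1 = 0"
  by (auto simp: rspan_singleton rscale_def vec_eq_iff forall_2 image_iff)

lemma line_inject: "line q = line r \<longleftrightarrow> q = r"
proof
  assume "line q = line r"
  moreover have "vector [1, q] \<in> line q" by (simp add: mem_line)
  ultimately have "vector [1, q] \<in> line r" by simp
  then show "q = r" by (simp add: mem_line)
qed simp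

lemma line_ne_vertical: "line q \<noteq> vertical_line" "vertical_line \<noteq> line q"
proof -
  have "vector [1, q] \<in> line q" "vector [1, q] \<notin> vertical_line"
    by (simp_all add: mem_line mem_vertical_line)
  then show "line q \<noteq> vertical_line" "vertical_line \<noteq> line q" by auto
qed

lemma rspan_eq_line:
  assumes "x \<noteq> 0"
  shows "rspan {vector [x, y] :: quat ^ 2} = line (y * inverse x)"
proof -
  have "w \<in> rspan {vector [x, y]} \<longleftrightarrow> w $ 2 = y * inverse x * w $ 1" for w :: "quat ^ 2"
  proof
    assume "w \<in> rspan {vector [x, y]}"
    then obtain a where w: "w = rscale (vector [x, y]) a" by (auto simp: rspan_singleton)
    have "inverse x * (x * a) = a" using assms by (simp add: mult.assoc[symmetric])
    then show "w $ 2 = y * inverse x * w $ 1" by (simp add: w rscale_def mult.assoc)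
  next
    assume "w $ 2 = y * inverse x * w $ 1"
    then have "w = rscale (vector [x, y]) (inverse x * w $ 1)"
      using assms by (simp add: rscale_def vec_eq_iff forall_2 mult.assoc[symmetric])
    then show "w \<in> rspan {vector [x, y]}" by (auto simp: rspan_singleton)
  qed
  then show ?thesis by (simp only: set_eq_iff mem_line simp_thms)
qed

lemma rspan_eq_vertical_line:
  assumes "y \<noteq> 0"
  shows "rspan {vector [0, y] :: quat ^ 2} = vertical_line"
proof -
  have "w \<in> rspan {vector [0, y]} \<longleftrightarrow> w $ 1 = 0" for w :: "quat ^ 2"
  proof
    assume "w $ 1 = 0"
    then have "w = rscale (vector [0, y]) (inverse y * w $ 2)"
      using assms by (simp add: rscale_def vec_eq_iff forall_2 mult.assoc[symmetric])
    then show "w \<in> rspan {vector [0, y]}" by (auto simp: rspan_singleton)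
  qed (auto simp: rspan_singleton rscale_def)
  then show ?thesis by (simp only: set_eq_iff mem_vertical_line simp_thms)
qed

lemma one_dimensional_iff:
  "one_dimensional V \<longleftrightarrow> V = vertical_line \<or> (\<exists>q. V = line q)"
proof
  assume "one_dimensional V"
  then obtain v where v: "v \<noteq> 0" "V = rspan {v}" by (auto simp: one_dimensional_def)
  have vec: "v = vector [v $ 1, v $ 2]" by (simp add: vec_eq_iff forall_2)
  show "V = vertical_line \<or> (\<exists>q. V = line q)"
  proof (cases "v $ 1 = 0")
    case True
    then have "v $ 2 \<noteq> 0" using v(1) by (auto simp: vec_eq_iff forall_2)
    then show ?thesis using True v(2) vec rspan_eq_vertical_line by metis
  next
    case False
    then show ?thesis using v(2) vec rspan_eq_line by metis
  qed
next
  have "vector [1, q] \<noteq> (0 :: quat ^ 2)" "vector [0, 1] \<noteq> (0 :: quat ^ 2)" for q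
    by (simp_all add: vec_eq_iff forall_2)
  then show "one_dimensional V" if "V = vertical_line \<or> (\<exists>q. V = line q)"
    using that unfolding one_dimensional_def by blast
qed

lemma is_direct_sum_commute: "is_direct_sum V W \<longleftrightarrow> is_direct_sum W V"
proof -
  have "{v + w | v w. v \<in> V \<and> w \<in> W} = {v + w | v w. v \<in> W \<and> w \<in> V}"
    by (auto) (metis add.commute)+
  then show ?thesis by (simp add: is_direct_sum_def Int_commute)
qed

lemma is_direct_sum_line_line:
  assumes "q \<noteq> r"
  shows "is_direct_sum (line q) (line r)"
proof -
  have "w = 0" if "w \<in> line q" "w \<in> line r" for w
  proof -
    have "(q - r) * w $ 1 = 0" using that by (simp add: mem_line algebra_simps)
    then have "w $ 1 = 0" using assms by simp
    then show ?thesis using that by (simp add: mem_line vec_eq_iff forall_2)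
  qed
  moreover have "\<exists>v w. u = v + w \<and> v \<in> line q \<and> w \<in> line r" for u
  proof -
    define x where "x = inverse (q - r) * (u $ 2 - r * u $ 1)"
    have x: "(q - r) * x = u $ 2 - r * u $ 1"
      using assms by (simp add: x_def mult.assoc[symmetric])
    have "u = vector [x, q * x] + vector [u $ 1 - x, r * (u $ 1 - x)]"
      using x by (simp add: vec_eq_iff forall_2 algebra_simps)
    moreover have "vector [x, q * x] \<in> line q" "vector [u $ 1 - x, r * (u $ 1 - x)] \<in> line r"
      by (simp_all add: mem_line)
    ultimately show ?thesis by blast
  qed
  moreover have "0 \<in> line q" "0 \<in> line r" by (simp_all add: mem_line)
  ultimately show ?thesis unfolding is_direct_sum_def by blast
qed

lemma is_direct_sum_line_vertical: "is_direct_sum (line q) vertical_line"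
proof -
  have "w = 0" if "w \<in> line q" "w \<in> vertical_line" for w
    using that by (simp add: mem_line mem_vertical_line vec_eq_iff forall_2)
  moreover have "\<exists>v w. u = v + w \<and> v \<in> line q \<and> w \<in> vertical_line" for u
  proof -
    have "u = vector [u $ 1, q * u $ 1] + vector [0, u $ 2 - q * u $ 1]"
      by (simp add: vec_eq_iff forall_2)
    moreover have "vector [u $ 1, q * u $ 1] \<in> line q"
      "vector [0, u $ 2 - q * u $ 1] \<in> vertical_line"
      by (simp_all add: mem_line mem_vertical_line)
    ultimately show ?thesis by blast
  qed
  moreover have "0 \<in> line q" "0 \<in> vertical_line"
    by (simp_all add: mem_line mem_vertical_line)
  ultimately show ?thesis unfolding is_direct_sum_def by blast
qed

text \<open>
  In dimension two the decomposition condition on a system of imprimitivity only says that its two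
  lines differ, so that a system is just a set of two slopes.
\<close>

lemma is_direct_sum_iff_ne:
  fixes V W :: "(quat ^ 2) set"
  assumes "one_dimensional V" "one_dimensional W"
  shows "is_direct_sum V W \<longleftrightarrow> V \<noteq> W"
proof
  assume VW: "is_direct_sum V W"
  show "V \<noteq> W"
  proof
    assume "V = W"
    then have "V = {0}" using VW by (simp add: is_direct_sum_def)
    moreover have "vector [1, q] \<in> line q" "vector [0, 1] \<in> vertical_line" for q
      by (simp_all add: mem_line mem_vertical_line)
    moreover have "vector [1, q] \<noteq> (0 :: quat ^ 2)" "vector [0, 1] \<noteq> (0 :: quat ^ 2)" for q
      by (simp_all add: vec_eq_iff forall_2)
    ultimately show False using assms(1) unfolding one_dimensional_iff by blast
  qed
next
  assume "V \<noteq> W"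
  then show "is_direct_sum V W"
    using assms is_direct_sum_line_line is_direct_sum_line_vertical is_direct_sum_commute
    unfolding one_dimensional_iff by metis
qed

lemma image_rspan_singleton:
  fixes g :: "quat ^ 'n ^ 'm"
  shows "(*v) g ` rspan {v} = rspan {g *v v}"
proof -
  have "g *v rscale v a = rscale (g *v v) a" for a
    by (simp add: rscale_def matrix_vector_mult_def vec_eq_iff sum_distrib_right mult.assoc)
  then show ?thesis by (auto simp: rspan_singleton image_image)
qed

section \<open>The action of monomial matrices on lines\<close>

lemma matrix2_vector2_mult:
  fixes a b c d x y :: "'a::semiring_1"
  shows "(vector [vector [a, b], vector [c, d]] :: 'a ^ 2 ^ 2) *v vector [x, y] =
    (vector [a * x + b * y, c * x + d * y] :: 'a ^ 2)"
  by (simp add: vec_eq_iff forall_2 matrix_vector_mult_def sum_2)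

lemma diag_image_line:
  assumes "a \<noteq> 0"
  shows "(*v) (vector [vector [a, 0], vector [0, d]]) ` line q = line (d * q * inverse a)"
  using rspan_eq_line[OF assms] by (simp add: image_rspan_singleton matrix2_vector2_mult)

lemma antidiag_image_line:
  assumes "b \<noteq> 0" "q \<noteq> 0"
  shows "(*v) (vector [vector [0, b], vector [c, 0]]) ` line q = line (c * inverse q * inverse b)"
  using assms rspan_eq_line[of "b * q" c]
  by (simp add: image_rspan_singleton matrix2_vector2_mult nonzero_inverse_mult_distrib mult.assoc)

lemma diag_image_standard_system:
  assumes "a \<noteq> 0" "d \<noteq> 0"
  shows "(\<lambda>V. (*v) (vector [vector [a, 0], vector [0, d]]) ` V) ` standard_system = standard_system"
  using assms diag_image_line[of a d 0] rspan_eq_vertical_line[of d]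
  by (simp add: standard_system_def image_rspan_singleton matrix2_vector2_mult)

lemma antidiag_image_standard_system:
  assumes "b \<noteq> 0" "c \<noteq> 0"
  shows "(*v) (vector [vector [0, b], vector [c, 0]]) ` line 0 = vertical_line"
    "(*v) (vector [vector [0, b], vector [c, 0]]) ` vertical_line = line 0"
    "(\<lambda>V. (*v) (vector [vector [0, b], vector [c, 0]]) ` V) ` standard_system = standard_system"
proof -
  show h: "(*v) (vector [vector [0, b], vector [c, 0]]) ` line 0 = vertical_line"
    "(*v) (vector [vector [0, b], vector [c, 0]]) ` vertical_line = line 0"
    using assms rspan_eq_line[of b 0] rspan_eq_vertical_line[of c]
    by (simp_all add: image_rspan_singleton matrix2_vector2_mult)
  show "(\<lambda>V. (*v) (vector [vector [0, b], vector [c, 0]]) ` V) ` standard_system = standard_system"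
    unfolding standard_system_def by (simp only: image_insert image_empty h) (rule insert_commute)
qed

lemma system_given_by_eq_lines:
  assumes "q \<noteq> 0"
  shows "system_given_by q = {line q, line (antipode q)}"
proof -
  have "qcnj q \<noteq> 0" using assms by (auto simp: quat_eq_iff)
  then have "rspan {vector [- qcnj q, 1]} = line (antipode q)"
    using rspan_eq_line[of "- qcnj q" 1] by (simp add: antipode_def)
  then show ?thesis by (simp only: system_given_by_altdef)
qed

section \<open>Systems of imprimitivity of a generated group\<close>

text \<open>
  The elements that map \<open>S\<close> onto itself form a group, so invariance has to be tested on generators only.
\<close>

lemma fixes_generate:
  fixes X :: "('a::semiring_1 ^ 'n ^ 'n) set" and S :: "('a ^ 'n) set set"
  assumes X: "X \<subseteq> carrier GL"
    and fix_X: "\<And>g. g \<in> X \<Longrightarrow> (\<lambda>V. (*v) g ` V) ` S = S"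
    and g: "g \<in> generate GL X"
  shows "(\<lambda>V. (*v) g ` V) ` S = S"
  using g
proof induction
  case one
  then show ?case by (simp add: GL_def)
next
  case (incl h)
  then show ?case by (rule fix_X)
next
  case (inv h)
  then have h: "h \<in> carrier GL" using X by blast
  interpret group "GL :: ('a ^ 'n ^ 'n) monoid" by (rule group_GL)
  let ?h' = "inv\<^bsub>GL\<^esub> h"
  have "?h' ** h = mat 1" using l_inv[OF h] by (simp add: GL_def)
  then have id: "(*v) ?h' ` ((*v) h ` V) = V" for V
    by (simp add: image_image matrix_vector_mul_assoc)
  have "(\<lambda>V. (*v) ?h' ` V) ` S = (\<lambda>V. (*v) ?h' ` V) ` ((\<lambda>V. (*v) h ` V) ` S)"
    by (simp only: fix_X[OF inv])
  also have "\<dots> = S" by (simp only: image_image[of "\<lambda>V. (*v) ?h' ` V"] id image_ident)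
  finally show ?case .
next
  case (eng g h)
  have "(*v) (g ** h) ` V = (*v) g ` ((*v) h ` V)" for V
    by (simp add: image_image matrix_vector_mul_assoc)
  then have "(\<lambda>V. (*v) (g ** h) ` V) ` S = (\<lambda>V. (*v) g ` V) ` ((\<lambda>V. (*v) h ` V) ` S)"
    by (simp only: image_image[of "\<lambda>V. (*v) g ` V"])
  also have "\<dots> = S" by (simp only: eng.IH)
  finally show ?case by (simp add: GL_def)
qed

lemma imprimitivity_system_generate:
  assumes "X \<subseteq> carrier GL"
  shows "imprimitivity_system (generate GL X) S \<longleftrightarrow> imprimitivity_system X S"
  unfolding imprimitivity_system_def using fixes_generate[OF assms, of S] generate.incl by metis

lemma imprimitivity_system_iff:
  "imprimitivity_system G S \<longleftrightarrow>
     (\<exists>V W. S = {V, W} \<and> one_dimensional V \<and> one_dimensional W \<and> V \<noteq> W) \<and>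
     (\<forall>g\<in>G. (\<lambda>V. (*v) g ` V) ` S = S)"
  unfolding imprimitivity_system_def using is_direct_sum_iff_ne by metis

text \<open>
  Slopes determine lines, so invariance of a pair of lines can be read off from the slopes alone.
\<close>

lemma image_lines_eq_iff:
  assumes "\<And>x. x \<in> {q, r} \<Longrightarrow> f (line x) = line (\<phi> x)"
  shows "f ` {line q, line r} = {line q, line r} \<longleftrightarrow> \<phi> ` {q, r} = {q, r}"
proof -
  have "f ` {line q, line r} = line ` (\<phi> ` {q, r})" using assms by simp
  moreover have "{line q, line r} = line ` {q, r}" by simp
  moreover have "inj line" by (rule injI) (simp add: line_inject)
  ultimately show ?thesis by (metis inj_image_eq_iff)
qed

section \<open>Roots of unity\<close>

definition primitive_root :: "nat \<Rightarrow> complex" where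
  "primitive_root n = exp (2 * complex_of_real pi * \<i> / of_nat n)"

lemma primitive_root_power_eq_1_iff:
  assumes "n \<ge> 1"
  shows "primitive_root n ^ k = 1 \<longleftrightarrow> n dvd k"
proof -
  have "primitive_root n ^ k = exp (2 * of_real pi * \<i> * of_nat k / of_nat n)"
    by (simp add: primitive_root_def flip: exp_of_nat_mult) (simp add: algebra_simps)
  then show ?thesis using complex_root_unity_eq_1[OF assms] by simp
qed

lemma primitive_root_times_cnj: "primitive_root n * cnj (primitive_root n) = 1"
  unfolding primitive_root_def by (simp add: exp_cnj flip: exp_add)

text \<open>
  If \<open>\<omega>\<^sup>p = - 1\<close>, then \<open>n\<close> divides \<open>2 p\<close> but not \<open>p\<close>; as \<open>p\<close> divides \<open>n\<close>, the quotient \<open>n / p\<close>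
  divides \<open>2\<close> and is not \<open>1\<close>.
\<close>

lemma primitive_root_power_eq_minus_1_iff:
  assumes "n \<ge> 1" "p dvd n"
  shows "primitive_root n ^ p = - 1 \<longleftrightarrow> 2 * p = n"
proof
  assume w: "primitive_root n ^ p = - 1"
  then have "primitive_root n ^ (2 * p) = 1" by (subst mult.commute) (simp add: power_mult)
  then have "n dvd 2 * p" using assms primitive_root_power_eq_1_iff by blast
  moreover have "\<not> n dvd p" using assms w primitive_root_power_eq_1_iff[of n p] by auto
  moreover obtain m where m: "n = p * m" using assms(2) by blast
  ultimately have "m dvd 2" "m \<noteq> 1" using assms(1) by (auto simp: mult.commute)
  then have "m = 2" using dvd_imp_le[of m 2] assms(1) m by (cases m) auto
  then show "2 * p = n" using m by simp
next
  assume n: "2 * p = n"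
  then have "(primitive_root n ^ p)\<^sup>2 = 1"
    using primitive_root_power_eq_1_iff[of n n] assms(1) by (simp add: power_mult[symmetric] mult.commute)
  moreover have "\<not> n dvd p" using n assms(1) by (auto dest: dvd_imp_le)
  ultimately show "primitive_root n ^ p = - 1"
    using primitive_root_power_eq_1_iff[of n p] assms(1) by (simp add: power2_eq_1_iff)
qed

section \<open>Invariant pairs of slopes\<close>

lemma pair_image_cases:
  assumes "f ` {q, r} = {q, r}" "q \<noteq> r"
  shows "f q = q \<and> f r = r \<or> f q = r \<and> f r = q"
  using assms by (auto simp: doubleton_eq_iff)

text \<open>
  The slopes of all lines in the nonstandard systems.  The values \<open>- 1\<close> and \<open>- i\<close> are the antipodes of
  \<open>1\<close> and \<open>i\<close> and give the same systems; including them makes the condition invariant under exchanging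
  the two lines of a system, so that the classification of pairs needs no choice of a first line.
\<close>
definition admissible :: "nat \<Rightarrow> nat \<Rightarrow> quat \<Rightarrow> bool" where
  "admissible n p q \<longleftrightarrow>
     (n = 4 \<and> (p = 4 \<or> p = 2)) \<and> (q = 1 \<or> q = quat_i \<or> q = - 1 \<or> q = - quat_i)
   \<or> p = n \<and> (\<exists>z. z \<noteq> 0 \<and> q = quat_of_complex z * quat_j)
   \<or> (even n \<and> p = n div 2) \<and> (\<exists>z. cmod z = 1 \<and> q = quat_of_complex z * quat_j)"

text \<open>
  Since \<open>j\<close> conjugates complex numbers, the right factor \<open>u\<close> reaches \<open>b\<close> as its conjugate and cancels
  the left factor; on \<open>a\<close> the two factors accumulate.
\<close>

lemma unit_sandwich_cd:
  assumes "u * cnj u = 1"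
  shows "quat_of_complex u * cd a b * quat_of_complex u = cd (u\<^sup>2 * a) b"
  using assms by (simp add: quat_of_complex_eq_cd cd_mult cd_inject power2_eq_square)

lemma cd_times_complex: "cd a b * quat_of_complex v = cd (a * v) (b * cnj v)"
  by (simp add: quat_of_complex_eq_cd cd_mult)

text \<open>
  A quaternion without complex part is purely imaginary, so conjugation only changes its sign.  Hence
  on these slopes the swap maps a line to its orthogonal complement.
\<close>

lemma inverse_cd_0: "inverse (cd 0 b) = antipode (cd 0 b)"
  by (simp add: inverse_cd antipode_cd)

text \<open>
  The case distinction is on whether \<open>x \<mapsto> u x u\<close>, the product of the first two generators acting on
  slopes, fixes \<open>q\<close> (no complex part) or moves it.
\<close>

lemma invariant_pair_imp:
  assumes n: "n \<ge> 3" "p dvd n" and ne: "q \<noteq> 0" "q \<noteq> r"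
    and \<omega>: "\<omega> = primitive_root n"
    and s: "inverse ` {q, r} = {q, r}"
    and t: "(\<lambda>x. quat_of_complex (cnj \<omega>) * inverse x * quat_of_complex (cnj \<omega>)) ` {q, r} = {q, r}"
    and d: "(\<lambda>x. x * quat_of_complex (cnj \<omega> ^ p)) ` {q, r} = {q, r}"
  shows "r = antipode q \<and> admissible n p q"
proof -
  define u where "u = cnj \<omega>"
  have \<omega>u: "\<omega> * u = 1" using primitive_root_times_cnj by (simp add: u_def \<omega>)
  then have u: "u * cnj u = 1" by (simp add: u_def mult.commute)
  have upow: "u ^ k = 1 \<longleftrightarrow> n dvd k" for k
  proof -
    have "u ^ k = 1 \<longleftrightarrow> \<omega> ^ k = 1" unfolding u_def by (metis complex_cnj_cnj complex_cnj_one complex_cnj_power)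
    then show ?thesis using primitive_root_power_eq_1_iff n(1) \<omega> by simp
  qed
  have upm: "u ^ p = - 1 \<longleftrightarrow> 2 * p = n"
  proof -
    have "u ^ p = - 1 \<longleftrightarrow> \<omega> ^ p = - 1" unfolding u_def
      by (metis complex_cnj_cnj complex_cnj_one complex_cnj_minus complex_cnj_power)
    then show ?thesis using primitive_root_power_eq_minus_1_iff n \<omega> by simp
  qed
  have dvd_p: "n dvd p \<longleftrightarrow> p = n" using n(2) by (auto intro: dvd_antisym)
  have half: "2 * p = n \<longleftrightarrow> even n \<and> p = n div 2" by auto
  obtain a b where q: "q = cd a b" by (rule cd_exhaust)
  define N where "N = cd_norm2 a b"
  have N: "N > 0" 
    using ne(1) cd_norm2_nonneg[of a b] cd_norm2_eq_0_iff[of a b]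
    by (auto simp: q N_def zero_eq_cd cd_inject less_le)
  have d': "q * quat_of_complex (u ^ p) \<in> {q, r}" using d unfolding u_def by blast
  have s': "inverse q \<in> {q, r}" using s by blast
  show ?thesis
  proof (cases "a = 0")
    case True
    have b: "b \<noteq> 0" using ne(1) True by (auto simp: q zero_eq_cd)
    have r: "r = antipode q"
      using s' antipode_ne[OF ne(1)] by (auto simp: q True inverse_cd_0)
    have "cd 0 (b * cnj u ^ p) = cd 0 b \<or> cd 0 (b * cnj u ^ p) = cd 0 (- b / of_real N)"
      using d' by (simp add: q r True cd_times_complex antipode_cd N_def)
    then have "b * cnj u ^ p = b * 1 \<or> b * cnj u ^ p = b * (- 1 / of_real N)"
      by (simp add: cd_inject)
    then have "cnj u ^ p = 1 \<or> cnj u ^ p = - 1 / of_real N"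
      using b by (simp only: mult_cancel_left simp_thms)
    then have "u ^ p = 1 \<or> u ^ p = - 1 \<and> N = 1"
    proof
      assume "cnj u ^ p = 1"
      then show ?thesis by (metis complex_cnj_cnj complex_cnj_one complex_cnj_power)
    next
      \<comment> \<open>Comparing absolute values forces the norm to be one.\<close>
      assume h: "cnj u ^ p = - 1 / of_real N"
      have "(cmod u)\<^sup>2 = 1\<^sup>2" using u complex_norm_square[of u] by (simp flip: of_real_power)
      then have "cmod u = 1" by (rule power2_eq_imp_eq) simp_all
      then have "cmod (cnj u ^ p) = 1" by (simp add: norm_power)
      then have "N = 1" using h N by (simp add: norm_divide)
      then show ?thesis using h
        by (metis complex_cnj_cnj complex_cnj_one complex_cnj_minus complex_cnj_power div_by_1 of_real_1)
    qed
    moreover have "cmod b = 1" if "N = 1"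
    proof -
      have "(cmod b)\<^sup>2 = 1\<^sup>2" using that by (simp add: N_def cd_norm2_def True)
      then show ?thesis by (rule power2_eq_imp_eq) simp_all
    qed
    ultimately have "p = n \<or> 2 * p = n \<and> cmod b = 1"
      using upow upm dvd_p by blast
    then have "admissible n p q"
      using b unfolding admissible_def half complex_times_j_eq_cd q True by blast
    then show ?thesis using r by blast
  next
    case False
    let ?\<rho> = "\<lambda>x. quat_of_complex u * x * quat_of_complex u"
    have "?\<rho> ` {q, r} = (\<lambda>x. quat_of_complex u * inverse x * quat_of_complex u) ` (inverse ` {q, r})"
      by (simp add: image_image)
    also have "\<dots> = {q, r}" using s t by (simp only: u_def)
    finally have \<rho>: "?\<rho> ` {q, r} = {q, r}" .
    have u2: "u\<^sup>2 \<noteq> 1" using upow[of 2] n(1) by (auto dest: dvd_imp_le)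
    have \<rho>q: "?\<rho> q = cd (u\<^sup>2 * a) b" unfolding q by (rule unit_sandwich_cd[OF u])
    then have "?\<rho> q \<noteq> q" using u2 False by (simp add: q cd_inject)
    then have r: "r = cd (u\<^sup>2 * a) b" and "?\<rho> r = q"
      using pair_image_cases[OF \<rho> ne(2)] \<rho>q by auto
    then have "cd (u\<^sup>2 * (u\<^sup>2 * a)) b = cd a b"
      using unit_sandwich_cd[OF u] q by simp
    then have u4: "u\<^sup>2 * u\<^sup>2 = 1" using False by (simp add: cd_inject)
    then have "u ^ 4 = 1" by (simp add: power2_eq_square power4_eq_xxxx mult.assoc)
    then have "n dvd 4" using upow by blast
    then have n4: "n = 4" using n(1) dvd_imp_le[of n 4] by (cases "n = 3") auto
    have "u\<^sup>2 = - 1" using u4[unfolded square_eq_1_iff] u2 by blast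
    then have r': "r = cd (- a) b" using r by simp
    have "cd (cnj a / of_real N) (- b / of_real N) \<in> {cd a b, cd (- a) b}"
      using s' by (simp add: q r' inverse_cd N_def)
    \<comment> \<open>Inversion multiplies the \<open>j\<close>-part by a negative real, whereas \<open>q\<close> and \<open>r\<close> share theirs.\<close>
    then have "- b / of_real N = b" and a: "cnj a / of_real N = a \<or> cnj a / of_real N = - a"
      by (auto simp: cd_inject)
    then have "b * of_real (1 + N) = 0" using N by (simp add: field_simps)
        (metis add.right_inverse)
    then have b: "b = 0" using N by (metis add_pos_pos less_irrefl mult_eq_0_iff of_real_eq_0_iff zero_less_one)
    have NN: "of_real N = a * cnj a" using complex_norm_square[of a] by (simp add: N_def cd_norm2_def b)
    have "a * a = 1 \<or> a * a = - 1" using a False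
      by (auto simp: NN field_simps minus_equation_iff)
    then have "(a - 1) * (a + 1) = 0 \<or> (a - \<i>) * (a + \<i>) = 0" by (auto simp: algebra_simps)
    then have a: "a = 1 \<or> a = \<i> \<or> a = - 1 \<or> a = - \<i>" by (auto simp: eq_neg_iff_add_eq_0)
    then have N1: "N = 1" by (auto simp: N_def cd_norm2_def b)
    have "antipode q = r" using N1 by (simp add: q r' b antipode_cd N_def)
    moreover have "a * u ^ p = a \<or> a * u ^ p = - a"
      using d' by (auto simp: q r' b cd_times_complex cd_inject)
    then have "u ^ p = 1 \<or> u ^ p = - 1" using False by (auto simp: minus_equation_iff[of _ a])
        (metis mult_cancel_left mult_minus_right mult.right_neutral)
    then have "p = 4 \<or> p = 2" using upow upm dvd_p n4 by auto
    moreover have "q = 1 \<or> q = quat_i \<or> q = - 1 \<or> q = - quat_i"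
      using a by (auto simp: q b cd_eq_Quat quat_eq_iff quat_i_def)
    ultimately show ?thesis using n4 unfolding admissible_def by blast
  qed
qed

text \<open>
  For \<open>q = b j\<close>, inversion exchanges \<open>q\<close> and its antipode, the second map agrees with inversion, and
  the third is the identity or, if \<open>\<bar>b\<bar> = 1\<close>, negation.  For \<open>q\<close> among \<open>\<plusminus>1\<close>, \<open>\<plusminus>i\<close> the antipode is
  \<open>- q\<close>, and every one of the maps is the identity or negation on \<open>{q, - q}\<close>.
\<close>

lemma admissible_imp_invariant_pair:
  assumes n: "n \<ge> 3" "p dvd n" and adm: "admissible n p q"
    and \<omega>: "\<omega> = primitive_root n"
    and r: "r = antipode q"
  shows "inverse ` {q, r} = {q, r}"
    and "(\<lambda>x. quat_of_complex (cnj \<omega>) * inverse x * quat_of_complex (cnj \<omega>)) ` {q, r} = {q, r}"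
    and "(\<lambda>x. x * quat_of_complex (cnj \<omega> ^ p)) ` {q, r} = {q, r}"
proof -
  define u where "u = cnj \<omega>"
  have u: "u * cnj u = 1" using primitive_root_times_cnj[of n] by (simp add: u_def \<omega> mult.commute)
  have w1: "\<omega> ^ k = 1 \<longleftrightarrow> n dvd k" for k
    using primitive_root_power_eq_1_iff n(1) \<omega> by simp
  have wm1: "\<omega> ^ k = - 1 \<longleftrightarrow> 2 * k = n" if "k dvd n" for k
    using primitive_root_power_eq_minus_1_iff that n(1) \<omega> by simp
  let ?t = "\<lambda>x. quat_of_complex (cnj \<omega>) * inverse x * quat_of_complex (cnj \<omega>)"
  let ?d = "\<lambda>x. x * quat_of_complex (cnj \<omega> ^ p)"
  have "inverse ` {q, r} = {q, r} \<and> ?t ` {q, r} = {q, r} \<and> ?d ` {q, r} = {q, r}"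
  proof (cases "\<exists>z. q = quat_of_complex z * quat_j")
    case True
    then obtain b where q: "q = cd 0 b" by (auto simp: complex_times_j_eq_cd)
    have iq: "inverse q = r" unfolding r q by (rule inverse_cd_0)
    then have ir: "inverse r = q" by (metis inverse_inverse_eq)
    have r0: "r = cd 0 (- b / of_real (cd_norm2 0 b))" by (simp add: r q antipode_cd)
    have tx: "?t x = inverse x" if "x \<in> {q, r}" for x
    proof -
      have "inverse x \<in> {cd 0 b, cd 0 (- b / of_real (cd_norm2 0 b))}"
        using that iq ir q r0 by auto
      then show ?thesis using unit_sandwich_cd[OF u, of 0] unfolding u_def by auto
    qed
    have dx: "?d (cd 0 y) = cd 0 (y * \<omega> ^ p)" for y
      by (simp only: cd_times_complex) simp
    have "p = n \<or> 2 * p = n \<and> cmod b = 1"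
      using adm unfolding admissible_def complex_times_j_eq_cd q
      by (auto simp: cd_inject) (auto simp: cd_eq_Quat quat_eq_iff quat_i_def)
    then have "?d ` {q, r} = {q, r}"
    proof
      assume "p = n"
      then have "\<omega> ^ p = 1" using w1 by simp
      then show ?thesis unfolding q r0 image_insert image_empty dx by simp
    next
      assume h: "2 * p = n \<and> cmod b = 1"
      then have "\<omega> ^ p = - 1" using wm1 n(2) by simp
      then show ?thesis unfolding q r0 image_insert image_empty dx using h
        by (simp add: cd_norm2_def insert_commute)
    qed
    then show ?thesis using tx iq ir by auto
  next
    case False
    then have n4: "n = 4" "p = 4 \<or> p = 2"
      and q': "q = 1 \<or> q = quat_i \<or> q = - 1 \<or> q = - quat_i"
      using adm unfolding admissible_def by blast+
    define a where "a = Complex (qRe q) (qI q)"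
    have a: "a = 1 \<or> a = \<i> \<or> a = - 1 \<or> a = - \<i>" and q: "q = cd a 0"
      using q' by (auto simp: a_def quat_i_def complex_eq_iff cd_eq_Quat quat_eq_iff)
    have N: "cd_norm2 a 0 = 1" using a by (auto simp: cd_norm2_def)
    have rr: "r = cd (- a) 0" using N by (simp add: r q antipode_cd)
    have ca: "cnj a = a \<or> cnj a = - a" using a by auto
    have iq: "inverse (cd a 0) = cd (cnj a) 0" using N by (simp add: inverse_cd)
    have ir: "inverse (cd (- a) 0) = cd (- cnj a) 0" using N by (simp add: inverse_cd cd_norm2_def)
    have "\<omega>\<^sup>2 = - 1" using wm1[of 2] n4 by simp
    then have u2: "u\<^sup>2 = - 1" unfolding u_def by (metis complex_cnj_minus complex_cnj_one complex_cnj_power)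
    have tx: "?t x = - inverse x" if "x = cd y 0" for x y
      using unit_sandwich_cd[OF u, of "cnj y / of_real (cd_norm2 y 0)" 0] u2
      unfolding that inverse_cd u_def[symmetric] by (simp add: uminus_cd)
    have "\<omega> ^ p = 1 \<or> \<omega> ^ p = - 1" using n4 w1[of 4] wm1[of 2] by auto
    then have up: "u ^ p = 1 \<or> u ^ p = - 1"
      unfolding u_def by (metis complex_cnj_minus complex_cnj_one complex_cnj_power)
    have dx: "?d (cd y 0) = cd (y * u ^ p) 0" for y
      by (simp add: cd_times_complex u_def)
    have "inverse ` {q, r} = {q, r}" using ca unfolding q rr image_insert image_empty iq ir by auto
    moreover have "?t ` {q, r} = {q, r}" using ca
      unfolding q rr image_insert image_empty tx[OF refl] unfolding iq ir uminus_cd by auto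
    moreover have "?d ` {q, r} = {q, r}" using up unfolding q rr image_insert image_empty dx by auto
    ultimately show ?thesis by blast
  qed
  then show "inverse ` {q, r} = {q, r}" "?t ` {q, r} = {q, r}" "?d ` {q, r} = {q, r}" by blast+
qed

section \<open>Systems of imprimitivity of the groups\<close>

lemma matrix2_mult:
  fixes a b c d a' b' c' d' :: "'a::semiring_1"
  shows "(vector [vector [a, b], vector [c, d]] :: 'a ^ 2 ^ 2) ** vector [vector [a', b'], vector [c', d']] =
    (vector [vector [a * a' + b * c', a * b' + b * d'],
             vector [c * a' + d * c', c * b' + d * d']] :: 'a ^ 2 ^ 2)"
  by (simp add: vec_eq_iff forall_2 matrix_matrix_mult_def sum_2)

lemma matrix2_eq_iff:
  "(vector [vector [a, b], vector [c, d]] :: 'a::zero ^ 2 ^ 2) = vector [vector [a', b'], vector [c', d']] \<longleftrightarrow>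
     a = a' \<and> b = b' \<and> c = c' \<and> d = d'"
  by (auto simp: vec_eq_iff forall_2)

lemma mat_1_eq_matrix2: "(mat 1 :: 'a::semiring_1 ^ 2 ^ 2) = vector [vector [1, 0], vector [0, 1]]"
  by (simp add: vec_eq_iff forall_2 mat_def)

lemma map_matrix_matrix2:
  "map_matrix quat_of_complex (vector [vector [a, b], vector [c, d]] :: complex ^ 2 ^ 2) =
     vector [vector [quat_of_complex a, quat_of_complex b],
             vector [quat_of_complex c, quat_of_complex d]]"
  by (simp add: vec_eq_iff forall_2)

definition Gnp2_generators :: "nat \<Rightarrow> nat \<Rightarrow> (complex ^ 2 ^ 2) set" where
  "Gnp2_generators n p =
     {vector [vector [0, 1], vector [1, 0]],
      vector [vector [0, primitive_root n], vector [cnj (primitive_root n), 0]],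
      vector [vector [primitive_root n ^ p, 0], vector [0, 1]]}"

lemma Gnp2_eq_generate: "Gnp2 n p = generate GL (Gnp2_generators n p)"
  by (simp add: Gnp2_def Gnp2_generators_def primitive_root_def Let_def)

lemma matrix2_in_GL:
  "a * d - b * c \<noteq> 0 \<Longrightarrow> (vector [vector [a, b], vector [c, d]] :: complex ^ 2 ^ 2) \<in> carrier GL"
  by (simp add: GL_def invertible_det_nz det_2)

lemma primitive_root_nonzero: "primitive_root n \<noteq> 0"
  by (simp add: primitive_root_def)

lemma Gnp2_generators_in_GL: "Gnp2_generators n p \<subseteq> carrier GL"
  unfolding Gnp2_generators_def
  by (auto intro!: matrix2_in_GL simp: primitive_root_nonzero)

lemma imprimitivity_system_Gnp2:
  "imprimitivity_system (over_quat (Gnp2 n p)) S \<longleftrightarrow>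
     imprimitivity_system (map_matrix quat_of_complex ` Gnp2_generators n p) S"
proof -
  interpret group_hom "GL :: (complex ^ 2 ^ 2) monoid" GL "map_matrix quat_of_complex"
    by (intro group_hom.intro group_hom_axioms.intro group_GL map_matrix_hom_GL)
  have "map_matrix quat_of_complex ` Gnp2_generators n p \<subseteq> carrier GL"
    using Gnp2_generators_in_GL by fastforce
  then show ?thesis
    unfolding over_quat_def Gnp2_eq_generate generate_img[OF Gnp2_generators_in_GL, symmetric]
    by (rule imprimitivity_system_generate)
qed

text \<open>
  A system with a coordinate axis contains both, as the swap exchanges them.  Every other system has
  two nonzero slopes, on which the generators act by the three maps of the classification of pairs.
\<close>

lemma imprimitivity_system_Gnp2_iff:
  assumes n: "n \<ge> 3" "p dvd n"
  shows "imprimitivity_system (over_quat (Gnp2 n p)) S \<longleftrightarrow>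
    S = standard_system \<or> (\<exists>q. q \<noteq> 0 \<and> admissible n p q \<and> S = system_given_by q)"
proof -
  define \<omega> where "\<omega> = primitive_root n"
  define \<sigma> :: "quat ^ 2 ^ 2" where "\<sigma> = vector [vector [0, 1], vector [1, 0]]"
  define \<tau> :: "quat ^ 2 ^ 2" where
    "\<tau> = vector [vector [0, quat_of_complex \<omega>], vector [quat_of_complex (cnj \<omega>), 0]]"
  define \<delta> :: "quat ^ 2 ^ 2" where
    "\<delta> = vector [vector [quat_of_complex (\<omega> ^ p), 0], vector [0, 1]]"
  have gens: "map_matrix quat_of_complex ` Gnp2_generators n p = {\<sigma>, \<tau>, \<delta>}"
    unfolding Gnp2_generators_def \<sigma>_def \<tau>_def \<delta>_def \<omega>_def
    by (simp only: image_insert image_empty map_matrix_matrix2 quat_of_complex_simps(1,2))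
  have nz: "quat_of_complex z \<noteq> 0" if "z \<noteq> 0" for z
    using that quat_of_complex_simps(1,7) by metis
  have \<omega>0: "\<omega> \<noteq> 0" by (simp add: \<omega>_def primitive_root_nonzero)
  have inv_\<omega>: "inverse \<omega> = cnj \<omega>"
    using primitive_root_times_cnj[of n] by (simp add: \<omega>_def inverse_unique)
  have nz\<omega>: "quat_of_complex \<omega> \<noteq> 0" "quat_of_complex (cnj \<omega>) \<noteq> 0" "quat_of_complex (\<omega> ^ p) \<noteq> 0"
    using \<omega>0 by (auto intro!: nz simp del: quat_of_complex_simps)
  have std: "(\<lambda>V. (*v) g ` V) ` standard_system = standard_system" if "g \<in> {\<sigma>, \<tau>, \<delta>}" for g
  proof -
    have "(\<lambda>V. (*v) \<sigma> ` V) ` standard_system = standard_system"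
      unfolding \<sigma>_def by (rule antidiag_image_standard_system(3)[OF one_neq_zero one_neq_zero])
    moreover have "(\<lambda>V. (*v) \<tau> ` V) ` standard_system = standard_system"
      unfolding \<tau>_def by (rule antidiag_image_standard_system(3)[OF nz\<omega>(1,2)])
    moreover have "(\<lambda>V. (*v) \<delta> ` V) ` standard_system = standard_system"
      unfolding \<delta>_def by (rule diag_image_standard_system[OF nz\<omega>(3) one_neq_zero])
    ultimately show ?thesis using that by (elim insertE emptyE) (simp_all only:)
  qed
  have \<sigma>_vert: "(*v) \<sigma> ` line 0 = vertical_line" "(*v) \<sigma> ` vertical_line = line 0"
    unfolding \<sigma>_def by (rule antidiag_image_standard_system(1,2)[OF one_neq_zero one_neq_zero])+
  let ?t = "\<lambda>x. quat_of_complex (cnj \<omega>) * inverse x * quat_of_complex (cnj \<omega>)"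
  let ?d = "\<lambda>x. x * quat_of_complex (cnj \<omega> ^ p)"
  have \<sigma>_line: "(*v) \<sigma> ` line x = line (inverse x)" if "x \<noteq> 0" for x
    using antidiag_image_line[OF one_neq_zero that, of 1]
    by (simp only: \<sigma>_def inverse_1 mult_1_left mult_1_right)
  have \<tau>_line: "(*v) \<tau> ` line x = line (?t x)" if "x \<noteq> 0" for x
    using antidiag_image_line[OF nz\<omega>(1) that]
    unfolding \<tau>_def quat_of_complex_inverse inv_\<omega> by blast
  have \<delta>_line: "(*v) \<delta> ` line x = line (?d x)" for x
    using diag_image_line[OF nz\<omega>(3), of 1 x]
    unfolding \<delta>_def quat_of_complex_inverse power_inverse[symmetric] inv_\<omega> by simp
  have invariant_iff: "(\<forall>g\<in>{\<sigma>, \<tau>, \<delta>}. (\<lambda>V. (*v) g ` V) ` {line q, line r} = {line q, line r}) \<longleftrightarrow>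
      inverse ` {q, r} = {q, r} \<and> ?t ` {q, r} = {q, r} \<and> ?d ` {q, r} = {q, r}"
    if "q \<noteq> 0" "r \<noteq> 0" for q r
  proof -
    have "(\<lambda>V. (*v) \<sigma> ` V) ` {line q, line r} = {line q, line r} \<longleftrightarrow> inverse ` {q, r} = {q, r}"
      by (rule image_lines_eq_iff) (use that \<sigma>_line in blast)
    moreover have "(\<lambda>V. (*v) \<tau> ` V) ` {line q, line r} = {line q, line r} \<longleftrightarrow> ?t ` {q, r} = {q, r}"
      by (rule image_lines_eq_iff) (use that \<tau>_line in blast)
    moreover have "(\<lambda>V. (*v) \<delta> ` V) ` {line q, line r} = {line q, line r} \<longleftrightarrow> ?d ` {q, r} = {q, r}"
      by (rule image_lines_eq_iff) (rule \<delta>_line)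
    ultimately show ?thesis by (simp only: ball_simps simp_thms)
  qed
  show ?thesis
    unfolding imprimitivity_system_Gnp2 gens
  proof
    assume "imprimitivity_system {\<sigma>, \<tau>, \<delta>} S"
    then obtain V W where S: "S = {V, W}" "V \<noteq> W" and VW: "one_dimensional V" "one_dimensional W"
      and inv: "\<forall>g\<in>{\<sigma>, \<tau>, \<delta>}. (\<lambda>V. (*v) g ` V) ` S = S"
      unfolding imprimitivity_system_iff by blast
    show "S = standard_system \<or> (\<exists>q. q \<noteq> 0 \<and> admissible n p q \<and> S = system_given_by q)"
    proof (cases "line 0 \<in> S \<or> vertical_line \<in> S")
      case True
      have "(\<lambda>V. (*v) \<sigma> ` V) ` S = S" using inv by blast
      then have "line 0 \<in> S \<and> vertical_line \<in> S" using True \<sigma>_vert by (metis imageI)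
      then have "S = {line 0, vertical_line}" using S line_ne_vertical by blast
      then show ?thesis by (simp add: standard_system_def)
    next
      case False
      obtain q r where qr: "V = line q" "W = line r"
        using VW False S unfolding one_dimensional_iff by blast
      have nz: "q \<noteq> 0" "r \<noteq> 0" "q \<noteq> r" using False S qr by auto
      have "r = antipode q \<and> admissible n p q"
        using invariant_pair_imp[OF n nz(1,3) \<omega>_def] invariant_iff[OF nz(1,2)] inv
        unfolding S qr by blast
      then show ?thesis using system_given_by_eq_lines[OF nz(1)] nz S qr by blast
    qed
  next
    assume "S = standard_system \<or> (\<exists>q. q \<noteq> 0 \<and> admissible n p q \<and> S = system_given_by q)"
    then consider "S = standard_system"
      | q where "q \<noteq> 0" "admissible n p q" "S = system_given_by q" by blast
    then show "imprimitivity_system {\<sigma>, \<tau>, \<delta>} S"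
    proof cases
      case 1
      have S: "S = {line 0, vertical_line}" using 1 by (simp add: standard_system_def)
      have dim: "one_dimensional (line 0)" "one_dimensional vertical_line"
        unfolding one_dimensional_iff by blast+
      have fix_S: "\<forall>g\<in>{\<sigma>, \<tau>, \<delta>}. (\<lambda>V. (*v) g ` V) ` S = S"
        unfolding 1 by (intro ballI std)
      show ?thesis
        unfolding imprimitivity_system_iff
        by (intro conjI exI) (rule S dim line_ne_vertical fix_S)+
    next
      case 2
      have S: "S = {line q, line (antipode q)}" using 2(3) system_given_by_eq_lines[OF 2(1)] by (rule trans)
      have ne: "line q \<noteq> line (antipode q)" using antipode_ne[OF 2(1)] by (metis line_inject)
      have dim: "one_dimensional (line q)" "one_dimensional (line (antipode q))"
        unfolding one_dimensional_iff by blast+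
      have fix_S: "\<forall>g\<in>{\<sigma>, \<tau>, \<delta>}. (\<lambda>V. (*v) g ` V) ` S = S"
        unfolding S invariant_iff[OF 2(1) antipode_nonzero[OF 2(1)]]
        by (intro conjI admissible_imp_invariant_pair[OF n 2(2) \<omega>_def refl])
      show ?thesis
        unfolding imprimitivity_system_iff by (intro conjI exI) (rule S dim ne fix_S)+
    qed
  qed
qed

lemma system_given_by_uminus_cong:
  "system_given_by (- 1) = system_given_by 1"
  "system_given_by (- quat_i) = system_given_by quat_i"
proof -
  have "antipode 1 = - 1" "antipode (- 1) = 1" "antipode quat_i = - quat_i" "antipode (- quat_i) = quat_i"
    by (simp_all add: antipode_def quat_eq_iff quat_i_def)
  moreover have "quat_i \<noteq> 0" by (simp add: quat_i_def quat_eq_iff)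
  ultimately show "system_given_by (- 1) = system_given_by 1"
    "system_given_by (- quat_i) = system_given_by quat_i"
    by (simp_all add: system_given_by_eq_lines insert_commute)
qed

section \<open>Relations between the groups\<close>

lemma (in group) generate_eqI:
  assumes "X \<subseteq> carrier G" "Y \<subseteq> carrier G" "X \<subseteq> generate G Y" "Y \<subseteq> generate G X"
  shows "generate G X = generate G Y"
  using assms generate_subgroup_incl generate_is_subgroup by (meson subset_antisym)

text \<open>
  For \<open>p = n\<close> the third generator is the identity matrix; the first two do not depend on \<open>p\<close>.
\<close>

lemma Gnp2_subset:
  assumes "even n" "n \<ge> 1"
  shows "Gnp2 n n \<subseteq> Gnp2 n (n div 2)"
proof -
  interpret group "GL :: (complex ^ 2 ^ 2) monoid" by (rule group_GL)
  have "primitive_root n ^ n = 1" using primitive_root_power_eq_1_iff[OF assms(2), of n] by simp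
  then have one: "vector [vector [primitive_root n ^ n, 0], vector [0, 1]] =
      \<one>\<^bsub>(GL :: (complex ^ 2 ^ 2) monoid)\<^esub>"
    by (simp add: GL_def mat_1_eq_matrix2)
  have "Gnp2_generators n n \<subseteq> generate GL (Gnp2_generators n (n div 2))"
    unfolding Gnp2_generators_def[of n n] one insert_subset
    by (intro conjI generate.one empty_subsetI generate.incl) (simp_all add: Gnp2_generators_def)
  then show ?thesis unfolding Gnp2_eq_generate
    by (rule generate_subgroup_incl[OF _ generate_is_subgroup[OF Gnp2_generators_in_GL]])
qed

lemma generate_matrix_mult:
  "g \<in> generate GL X \<Longrightarrow> h \<in> generate GL X \<Longrightarrow> g ** h \<in> generate GL X"
  using generate.eng[of g GL X h] by (simp add: GL_def)

abbreviation quarter_turn :: "complex ^ 2 ^ 2" where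
  "quarter_turn \<equiv> vector [vector [0, - 1], vector [1, 0]]"

abbreviation axis_reflection :: "complex ^ 2 ^ 2" where
  "axis_reflection \<equiv> vector [vector [1, 0], vector [0, - 1]]"

abbreviation swap_matrix :: "complex ^ 2 ^ 2" where
  "swap_matrix \<equiv> vector [vector [0, 1], vector [1, 0]]"

text \<open>
  The two reflections serve as a common target: \<open>G(2,1,2)\<close> and the conjugate of \<open>G(4,4,2)\<close> are both
  compared with \<open>D\<^sub>4\<close> in this form.
\<close>

lemma D4_eq_generate_reflections: "D4 = generate GL {axis_reflection, swap_matrix}"
proof -
  interpret group "GL :: (complex ^ 2 ^ 2) monoid" by (rule group_GL)
  let ?X = "{quarter_turn, axis_reflection}" and ?Y = "{axis_reflection, swap_matrix}"
  have "quarter_turn ** axis_reflection = swap_matrix" "swap_matrix ** axis_reflection = quarter_turn"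
    by (simp_all add: matrix2_mult)
  then have "swap_matrix \<in> generate GL ?X" "quarter_turn \<in> generate GL ?Y"
    using generate_matrix_mult generate.incl by (metis insertI1 insertI2)+
  then show ?thesis
    unfolding D4_def by (intro generate_eqI) (auto intro!: matrix2_in_GL intro: generate.incl)
qed

lemma primitive_root_2: "primitive_root 2 = - 1"
  using primitive_root_power_eq_minus_1_iff[of 2 1] by simp

lemma primitive_root_4: "primitive_root 4 = \<i>"
  by (simp add: primitive_root_def exp_eq_polar complex_eq_iff)

lemma D4_eq_Gnp2_2_1: "D4 = Gnp2 2 1"
proof -
  interpret group "GL :: (complex ^ 2 ^ 2) monoid" by (rule group_GL)
  let ?X = "{axis_reflection, swap_matrix}"
  let ?s' = "vector [vector [0, - 1], vector [- 1, 0]] :: complex ^ 2 ^ 2"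
  let ?d' = "vector [vector [- 1, 0], vector [0, 1]] :: complex ^ 2 ^ 2"
  let ?Y = "{swap_matrix, ?s', ?d'}"
  have Y: "Gnp2_generators 2 1 = ?Y"
    by (simp add: Gnp2_generators_def primitive_root_2)
  have "swap_matrix ** axis_reflection ** swap_matrix = ?d'" "axis_reflection ** swap_matrix ** axis_reflection = ?s'"
    "swap_matrix ** ?d' ** swap_matrix = axis_reflection"
    by (simp_all add: matrix2_mult)
  then have "?d' \<in> generate GL ?X" "?s' \<in> generate GL ?X" "axis_reflection \<in> generate GL ?Y"
    using generate_matrix_mult generate.incl by (metis insertI1 insertI2)+
  then show ?thesis
    unfolding D4_eq_generate_reflections Gnp2_eq_generate Y
    by (intro generate_eqI) (auto intro!: matrix2_in_GL intro: generate.incl)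
qed

lemma matrix_inv_cancel:
  assumes "invertible A"
  shows "A ** matrix_inv A = mat 1" "matrix_inv A ** A = mat 1"
  using someI_ex[OF assms[unfolded invertible_def]] unfolding matrix_inv_def by blast+

lemma conjugation_hom:
  assumes "invertible (A :: complex ^ 'n ^ 'n)"
  shows "(\<lambda>g. A ** g ** matrix_inv A) \<in> hom GL GL"
proof -
  have inv: "matrix_inv A ** A = mat 1" "A ** matrix_inv A = mat 1"
    using matrix_inv_cancel[OF assms] by blast+
  have "A ** (g ** h) ** matrix_inv A = (A ** g ** matrix_inv A) ** (A ** h ** matrix_inv A)" for g h
  proof -
    have "(A ** g ** matrix_inv A) ** (A ** h ** matrix_inv A) =
        A ** g ** (matrix_inv A ** A) ** h ** matrix_inv A"
      by (simp only: matrix_mul_assoc)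
    then show ?thesis by (simp only: inv matrix_mul_rid matrix_mul_assoc)
  qed
  moreover have "invertible (matrix_inv A)" using inv unfolding invertible_def by blast
  ultimately show ?thesis
    using assms by (auto simp: hom_def GL_def intro!: invertible_mult)
qed

text \<open>
  The group \<open>G(4,4,2)\<close> is generated by the swap \<open>s\<close> and a second involution \<open>t\<close>.  The rows of \<open>A\<close> are
  left eigenvectors of \<open>s\<close> for the eigenvalues \<open>1\<close> and \<open>- 1\<close>, so that conjugation by \<open>A\<close> turns \<open>s\<close> into
  the reflection \<open>diag(1, - 1)\<close>; the second row is scaled so that \<open>t\<close>, which exchanges the two eigenlines,
  exchanges the two rows exactly and becomes the swap.
\<close>

lemma Gnp2_4_4_conjugate_D4: "conjugate_in_GL (Gnp2 4 4) D4"
proof -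
  define A :: "complex ^ 2 ^ 2" where "A = vector [vector [1, 1], vector [- \<i>, \<i>]]"
  define \<phi> where "\<phi> = (\<lambda>g. A ** g ** matrix_inv A)"
  have A: "invertible A" by (simp add: A_def invertible_det_nz det_2)
  interpret group_hom "GL :: (complex ^ 2 ^ 2) monoid" GL \<phi>
    unfolding \<phi>_def by (intro group_hom.intro group_hom_axioms.intro group_GL conjugation_hom A)
  let ?t = "vector [vector [0, \<i>], vector [- \<i>, 0]] :: complex ^ 2 ^ 2"
  have gens: "Gnp2_generators 4 4 = {swap_matrix, ?t, mat 1}"
    by (simp add: Gnp2_generators_def primitive_root_4 mat_1_eq_matrix2)
  have conj: "\<phi> g = h" if "A ** g = h ** A" for g h
  proof -
    have "\<phi> g = h ** (A ** matrix_inv A)" by (simp only: \<phi>_def that matrix_mul_assoc)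
    then show ?thesis using matrix_inv_cancel(1)[OF A] by (simp only: matrix_mul_rid)
  qed
  have "\<phi> swap_matrix = axis_reflection" "\<phi> ?t = swap_matrix" "\<phi> (mat 1) = mat 1"
    by (rule conj; simp add: A_def matrix2_mult matrix2_eq_iff mat_1_eq_matrix2)+
  then have img: "\<phi> ` Gnp2_generators 4 4 = {axis_reflection, swap_matrix, mat 1}"
    by (simp only: gens image_insert image_empty)
  have "mat 1 \<in> generate GL {axis_reflection, swap_matrix}"
    using generate.one[of GL "{axis_reflection, swap_matrix}"] by (simp add: GL_def)
  then have "generate GL {axis_reflection, swap_matrix, mat 1} = D4"
    unfolding D4_eq_generate_reflections
    by (intro group.generate_eqI[OF group_GL]) (auto intro!: matrix2_in_GL intro: generate.incl simp: mat_1_eq_matrix2)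
  then have "\<phi> ` Gnp2 4 4 = D4"
    by (simp only: Gnp2_eq_generate generate_img[OF Gnp2_generators_in_GL, symmetric] img)
  then show ?thesis using A unfolding conjugate_in_GL_def \<phi>_def by blast
qed

theorem theorem4p1:
  fixes n p :: nat
  assumes "n \<ge> 3" and "p dvd n"
  shows
    "{S. imprimitivity_system (over_quat (Gnp2 n p)) S} =
       insert standard_system
         {system_given_by q | q. q \<noteq> 0 \<and>
            ((n = 4 \<and> (p = 4 \<or> p = 2)) \<and> (q = 1 \<or> q = quat_i)
           \<or> p = n \<and> (\<exists>z. z \<noteq> 0 \<and> q = quat_of_complex z * quat_j)
           \<or> (even n \<and> p = n div 2) \<and> (\<exists>z. cmod z = 1 \<and> q = quat_of_complex z * quat_j))}
     \<and> Gnp2 4 4 \<subseteq> Gnp2 4 2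
     \<and> D4 = Gnp2 2 1
     \<and> conjugate_in_GL (Gnp2 4 4) D4
     \<and> (even n \<longrightarrow> Gnp2 n n \<subseteq> Gnp2 n (n div 2))"
proof (intro conjI impI)
  let ?R = "\<lambda>q. (n = 4 \<and> (p = 4 \<or> p = 2)) \<and> (q = 1 \<or> q = quat_i)
           \<or> p = n \<and> (\<exists>z. z \<noteq> 0 \<and> q = quat_of_complex z * quat_j)
           \<or> (even n \<and> p = n div 2) \<and> (\<exists>z. cmod z = 1 \<and> q = quat_of_complex z * quat_j)"
  \<comment> \<open>It remains to replace the slopes \<open>- 1\<close> and \<open>- i\<close> by their antipodes \<open>1\<close> and \<open>i\<close>.\<close>
  have nz: "(1 :: quat) \<noteq> 0" "quat_i \<noteq> 0" by (simp_all add: quat_eq_iff quat_i_def)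
  have "(\<exists>q. q \<noteq> 0 \<and> admissible n p q \<and> S = system_given_by q) \<longleftrightarrow>
      (\<exists>q. S = system_given_by q \<and> q \<noteq> 0 \<and> ?R q)" for S
  proof
    assume "\<exists>q. q \<noteq> 0 \<and> admissible n p q \<and> S = system_given_by q"
    then obtain q where q: "q \<noteq> 0" "admissible n p q" "S = system_given_by q" by blast
    then consider "?R q" | "n = 4 \<and> (p = 4 \<or> p = 2)" "q = - 1 \<or> q = - quat_i"
      unfolding admissible_def by blast
    then show "\<exists>q. S = system_given_by q \<and> q \<noteq> 0 \<and> ?R q"
      by cases (use q nz system_given_by_uminus_cong in metis)+
  qed (unfold admissible_def, blast)
  then show "{S. imprimitivity_system (over_quat (Gnp2 n p)) S} =
       insert standard_system {system_given_by q | q. q \<noteq> 0 \<and> ?R q}"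
    by (simp only: set_eq_iff mem_Collect_eq insert_iff imprimitivity_system_Gnp2_iff[OF assms] simp_thms)
  show "Gnp2 4 4 \<subseteq> Gnp2 4 2" using Gnp2_subset[of 4] by simp
  show "D4 = Gnp2 2 1" by (rule D4_eq_Gnp2_2_1)
  show "conjugate_in_GL (Gnp2 4 4) D4" by (rule Gnp2_4_4_conjugate_D4)
  show "Gnp2 n n \<subseteq> Gnp2 n (n div 2)" if "even n" using Gnp2_subset that assms(1) by simp
qed

end
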